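(* Equip each straight snake graph $\mathcal{G}^s_N$ with its standard labeling. Then: (a) For every $n\ge2$, $|\Omega(\mathcal{G}^s_{n-2})| = E_n$. (b) For every $n\ge3$ and $1\le k\le n$, the number of mixed dimer covers of $\mathcal{G}^s_{n-2}$ (standard labeling) in which the right-most vertical edge has multiplicity $n-k$ equals the Entringer number $E_{n,n+1-k}$. Moreover, for $n\ge 4$, this number also equals the number of mixed dimer covers of $\mathcal{G}^s_{n-3}$ with vertex labeling $\mathbf{n}_x$, $x=(1,2,\dots,n-3,\,n-1-k)$ (interpreted as $0$ when $n-1-k<0$).
   Context: Mixed dimer covers: for a finite graph $\mathcal{G}=(V,E)$ and $\mathbf{n}\colon V\to\mathbb{N}$, a mixed dimer cover is a function $\omega\colon E\to\mathbb{N}$ (edge multiplicities) with $\sum_{e\ni v}\omega(e)=\mathbf{n}(v)$ for each vertex $v$. $\mathcal{G}^s_N$ is the $2\times(N+1)$ grid graph with bottom vertices $v_{1,0},\dots,v_{1,N}$ and top vertices $v_{2,0},\dots,v_{2,N}$, vertical edges $v_{1,k}v_{2,k}$ and horizontal edges $v_{r,k-1}v_{r,k}$. For $x=(x_0,\dots,x_N)$, the labeling $\mathbf{n}_x$ gives both $v_{1,k},v_{2,k}$ the value $x_k$. The standard labeling of $\mathcal{G}^s_N$ is $\mathbf{n}_x$ with $x=(1,2,\dots,N+1)$, and $\Omega(\mathcal{G}^s_N)$ denotes the set of mixed dimer covers for the standard labeling. A permutation $\sigma\in S_n$ is alternating if $\sigma(1)>\sigma(2)<\sigma(3)>\sigma(4)<\cdots$.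 The Euler number $E_n$ is the number of alternating permutations in $S_n$, and the Entringer number $E_{n,k}$ is the number of alternating $\sigma\in S_n$ with $\sigma(1)=k$. *)

theory Defs
  imports Main "HOL-Library.FuncSet" "HOL-Combinatorics.Permutations"
begin

text \<open>A graph is a pair of a vertex set and a set of edges, each edge being the set of its two
  endpoints.\<close>

type_synonym 'a graph = "'a set \<times> 'a set set"

abbreviation verts :: "'a graph \<Rightarrow> 'a set" where "verts G \<equiv> fst G"
abbreviation edges :: "'a graph \<Rightarrow> 'a set set" where "edges G \<equiv> snd G"

definition finite_graph :: "'a graph \<Rightarrow> bool" where
  "finite_graph G \<longleftrightarrow> finite (verts G) \<and> (\<forall>e\<in>edges G. e \<subseteq> verts G \<and> card e = 2)"

text \<open>Extensional functions are used so that functions on the edge set are counted correctly.\<close>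

definition mixed_dimer_covers :: "'a graph \<Rightarrow> ('a \<Rightarrow> nat) \<Rightarrow> ('a set \<Rightarrow> nat) set" where
  "mixed_dimer_covers G lab =
    {\<omega> \<in> edges G \<rightarrow>\<^sub>E UNIV. \<forall>v\<in>verts G. (\<Sum>e\<in>{e\<in>edges G. v \<in> e}. \<omega> e) = lab v}"

text \<open>The vertex \<open>v\<^bsub>r,k\<^esub>\<close> is the pair \<open>(r, k)\<close>.\<close>

definition vertical_edge :: "nat \<Rightarrow> (nat \<times> nat) set" where
  "vertical_edge k = {(1, k), (2, k)}"

definition horizontal_edge :: "nat \<Rightarrow> nat \<Rightarrow> (nat \<times> nat) set" where
  "horizontal_edge r k = {(r, k - 1), (r, k)}"

definition straight_snake :: "nat \<Rightarrow> (nat \<times> nat) graph" where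
  "straight_snake N =
    ({1, 2} \<times> {0..N},
     {vertical_edge k |k. k \<in> {0..N}} \<union>
     {horizontal_edge r k |r k. r \<in> {1, 2} \<and> k \<in> {1..N}})"

text \<open>Here \<open>x\<close> is the list of the column labels \<open>x\<^sub>0, \<dots>, x\<^sub>N\<close>.\<close>

definition column_labeling :: "nat list \<Rightarrow> nat \<times> nat \<Rightarrow> nat" where
  "column_labeling x = (\<lambda>(r, k). x ! k)"

definition standard_covers :: "nat \<Rightarrow> ((nat \<times> nat) set \<Rightarrow> nat) set" where
  "standard_covers N = mixed_dimer_covers (straight_snake N) (column_labeling [1..<N + 2])"

definition alternating :: "nat \<Rightarrow> (nat \<Rightarrow> nat) \<Rightarrow> bool" where
  "alternating n \<sigma> \<longleftrightarrow>
    (\<forall>i\<in>{1..<n}. if odd i then \<sigma> i > \<sigma> (i + 1) else \<sigma> i < \<sigma> (i + 1))"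

definition euler_number :: "nat \<Rightarrow> nat" where
  "euler_number n = card {\<sigma>. \<sigma> permutes {1..n} \<and> alternating n \<sigma>}"

definition entringer_number :: "nat \<Rightarrow> nat \<Rightarrow> nat" where
  "entringer_number n k = card {\<sigma>. \<sigma> permutes {1..n} \<and> alternating n \<sigma> \<and> \<sigma> 1 = k}"

lemma finite_graph_straight_snake: "finite_graph (straight_snake N)"
  by (auto simp: finite_graph_def straight_snake_def vertical_edge_def horizontal_edge_def
      card_insert_if)

lemma finite_mixed_dimer_covers:
  assumes "finite_graph G"
  shows "finite (mixed_dimer_covers G lab)"
proof -
  have fV: "finite (verts G)" using assms by (simp add: finite_graph_def)
  have "edges G \<subseteq> Pow (verts G)" using assms by (auto simp: finite_graph_def)
  then have fE: "finite (edges G)" using fV finite_subset by blast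
  have "mixed_dimer_covers G lab \<subseteq> (\<Pi>\<^sub>E e\<in>edges G. {.. Max (lab ` verts G)})"
  proof
    fix \<omega> assume w: "\<omega> \<in> mixed_dimer_covers G lab"
    have "\<omega> e \<le> Max (lab ` verts G)" if e: "e \<in> edges G" for e
    proof -
      have "e \<noteq> {}" "e \<subseteq> verts G" using assms e by (auto simp: finite_graph_def)
      then obtain v where v: "v \<in> e" "v \<in> verts G" by blast
      have "\<omega> e \<le> (\<Sum>e\<in>{e\<in>edges G. v \<in> e}. \<omega> e)"
        using fE e v by (intro member_le_sum) auto
      also have "\<dots> = lab v" using w v by (simp add: mixed_dimer_covers_def)
      also have "\<dots> \<le> Max (lab ` verts G)" using fV v by simp
      finally show ?thesis .
    qed
    then show "\<omega> \<in> (\<Pi>\<^sub>E e\<in>edges G. {.. Max (lab ` verts G)})"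
      using w by (auto simp: mixed_dimer_covers_def PiE_def Pi_def)
  qed
  then show ?thesis using fE by (meson finite_PiE finite_atMost finite_subset)
qed

end

theory Submission
  imports Defs
begin

text \<open>Both families satisfy Entringer's recursion. If the last vertical edge of a cover of
  \<open>\<G>\<^sup>s\<^bsub>N+1\<^esub>\<close> has multiplicity \<open>m\<close>, then both horizontal edges next to it have multiplicity
  \<open>h = b - m\<close>, where \<open>b\<close> is the last label. Deleting the last column leaves an arbitrary cover of
  \<open>\<G>\<^sup>s\<^bsub>N\<^esub>\<close> for the remaining labels, with the last of them lowered by \<open>h\<close>. Dually, deleting the first letter \<open>k\<close> of an
  alternating word leaves a word of the opposite kind that starts below \<open>k\<close>. Only the relative
  order of the letters matters, so words are counted over an arbitrary finite linear order \<open>R\<close>, and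
  the opposite kind is the same kind for the converse of \<open>R\<close>.\<close>

text \<open>The Entringer triangle with shifted indices: \<open>zigzag_number n r = E\<^bsub>n+1,r+1\<^esub>\<close> for \<open>r \<le> n\<close>.
  Values at \<open>r > n\<close> are junk.\<close>

fun zigzag_number :: "nat \<Rightarrow> nat \<Rightarrow> nat" where
  "zigzag_number 0 r = 1"
| "zigzag_number (Suc n) r = (\<Sum>s<r. zigzag_number n (n - s))"

section \<open>Alternating words over a finite linear order\<close>

fun zigzag :: "('a \<Rightarrow> 'a \<Rightarrow> bool) \<Rightarrow> 'a list \<Rightarrow> bool" where
  "zigzag R (x # y # zs) \<longleftrightarrow> R y x \<and> zigzag R\<inverse>\<inverse> (y # zs)"
| "zigzag R _ \<longleftrightarrow> True"

text \<open>Bridge from the recursive form to comparisons by position. Dropping the first letter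
  shifts every position by one, which swaps even and odd; replacing \<open>R\<close> by its converse
  undoes exactly this swap.\<close>

lemma zigzag_iff_nth:
  "zigzag R xs \<longleftrightarrow>
    (\<forall>i. Suc i < length xs \<longrightarrow>
      (if even i then R (xs ! Suc i) (xs ! i) else R (xs ! i) (xs ! Suc i)))"
proof (induction R xs rule: zigzag.induct)
  case (1 R x y zs)
  have all: "(\<forall>i. Suc i < length (x # y # zs) \<longrightarrow> P i) \<longleftrightarrow>
      P 0 \<and> (\<forall>i. Suc i < length (y # zs) \<longrightarrow> P (Suc i))" for P
    by (auto simp: less_Suc_eq_0_disj)
  have "zigzag R (x # y # zs) \<longleftrightarrow> R y x \<and> (\<forall>i. Suc i < length (y # zs) \<longrightarrow>
      (if even i then R\<inverse>\<inverse> ((y # zs) ! Suc i) ((y # zs) ! i)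
       else R\<inverse>\<inverse> ((y # zs) ! i) ((y # zs) ! Suc i)))"
    by (simp only: zigzag.simps 1)
  also have "\<dots> \<longleftrightarrow> (\<forall>i. Suc i < length (x # y # zs) \<longrightarrow>
      (if even i then R ((x # y # zs) ! Suc i) ((x # y # zs) ! i)
       else R ((x # y # zs) ! i) ((x # y # zs) ! Suc i)))"
    unfolding all by simp meson
  finally show ?case .
qed auto

definition zigzag_lists :: "('a \<Rightarrow> 'a \<Rightarrow> bool) \<Rightarrow> 'a set \<Rightarrow> 'a \<Rightarrow> 'a list set" where
  "zigzag_lists R S k = {xs. distinct xs \<and> set xs = S \<and> zigzag R xs \<and> xs \<noteq> [] \<and> hd xs = k}"

lemma finite_zigzag_lists: "finite S \<Longrightarrow> finite (zigzag_lists R S k)"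
  by (rule finite_subset[OF _ finite_subset_distinct[of S]]) (auto simp: zigzag_lists_def)

text \<open>This turns a sum over letters below \<open>k\<close> into a sum over an initial segment
  of numbers. Rank is strictly monotone, hence injective on the letters below \<open>k\<close>, and
  each of their ranks is smaller than that of \<open>k\<close>; equality of cardinalities then gives
  surjectivity. The letter \<open>k\<close> itself may lie outside \<open>S\<close>, as it does once
  it has been deleted.\<close>

lemma bij_betw_rank:
  assumes R: "irreflp R" "transp R" "totalp R" and S: "finite S"
  shows "bij_betw (\<lambda>j. card {i \<in> S. R i j}) {j \<in> S. R j k} {..<card {j \<in> S. R j k}}"
proof -
  let ?T = "{j \<in> S. R j k}" and ?rk = "\<lambda>j. card {i \<in> S. R i j}"
  have mono: "?rk i < ?rk j" if "i \<in> S" "R i j" for i j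
  proof (rule psubset_card_mono)
    have "{i' \<in> S. R i' i} \<subseteq> {i' \<in> S. R i' j}" using that R(2) by (auto dest: transpD)
    moreover have "i \<notin> {i' \<in> S. R i' i}" using R(1) by (auto dest: irreflpD)
    ultimately show "{i' \<in> S. R i' i} \<subset> {i' \<in> S. R i' j}" using that by blast
  qed (use S in auto)
  have inj: "inj_on ?rk ?T"
  proof (rule inj_onI, rule ccontr)
    fix i j assume "i \<in> ?T" "j \<in> ?T" "?rk i = ?rk j" "i \<noteq> j"
    then show False using mono[of i j] mono[of j i] R(3) by (auto dest: totalpD)
  qed
  moreover have "?rk ` ?T \<subseteq> {..<card ?T}" using mono[of _ k] by auto
  ultimately have "?rk ` ?T = {..<card ?T}"
    by (intro card_subset_eq) (auto simp: card_image)
  with inj show ?thesis by (simp add: bij_betw_def)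
qed

text \<open>The induction generalizes \<open>R\<close> as well as \<open>S\<close> and
  \<open>k\<close>, since each deleted letter reverses the order. The second letter \<open>j\<close>
  ranges over the letters below \<open>k\<close>, and its rank in the converse order yields the
  reflected index \<open>n - s\<close> of the Entringer recursion.\<close>

lemma card_zigzag_lists:
  assumes "irreflp R" "transp R" "totalp R" "finite S" "card S = Suc n" "k \<in> S"
  shows "card (zigzag_lists R S k) = zigzag_number n (card {j \<in> S. R j k})"
  using assms
proof (induction n arbitrary: R S k)
  case 0
  then have "S = {k}" by (auto simp: card_1_singleton_iff)
  have "zigzag_lists R S k = {[k]}"
  proof (rule set_eqI)
    fix xs show "xs \<in> zigzag_lists R S k \<longleftrightarrow> xs \<in> {[k]}"
      unfolding zigzag_lists_def \<open>S = {k}\<close>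
      by (cases xs rule: zigzag.cases[of "(R, xs)" for xs, simplified]) auto
  qed
  then show ?case by simp
next
  case (Suc n)
  let ?S = "S - {k}" and ?r = "card {j \<in> S. R j k}"
  have fin: "finite ?S" and card: "card ?S = Suc n" using Suc.prems by auto
  have irr: "\<not> R i i" for i by (rule irreflpD[OF Suc.prems(1)])
  have T: "{j \<in> ?S. R j k} = {j \<in> S. R j k}" using irr by auto
  let ?L = "\<lambda>j. (#) k ` zigzag_lists R\<inverse>\<inverse> ?S j"
  have "zigzag_lists R S k = (\<Union>j\<in>{j \<in> ?S. R j k}. ?L j)"
  proof (rule set_eqI)
    fix xs
    show "xs \<in> zigzag_lists R S k \<longleftrightarrow> xs \<in> (\<Union>j\<in>{j \<in> ?S. R j k}. ?L j)"
    proof (cases xs)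
      case Nil
      then show ?thesis by (auto simp: zigzag_lists_def)
    next
      case (Cons x ys)
      \<comment> \<open>\<open>S\<close> has at least two elements here, so every word has a second
        letter and the first clause of \<open>zigzag\<close> applies.\<close>
      have "ys \<noteq> []" if "set xs = S" "distinct xs"
        using that Cons Suc.prems(5) distinct_card[OF that(2)] by auto
      then show ?thesis unfolding Cons
        by (cases ys) (use Cons Suc.prems(6) in \<open>auto simp: zigzag_lists_def image_iff\<close>)
    qed
  qed
  then have "card (zigzag_lists R S k) = card (\<Union>j\<in>{j \<in> ?S. R j k}. ?L j)" by (rule arg_cong)
  also have "\<dots> = (\<Sum>j\<in>{j \<in> ?S. R j k}. card (?L j))"
  proof (rule card_UN_disjoint)
    have "?L i \<inter> ?L j = {}" if "i \<noteq> j" for i j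
      using that by (auto simp: zigzag_lists_def)
    then show "\<forall>i\<in>{j \<in> ?S. R j k}. \<forall>j\<in>{j \<in> ?S. R j k}. i \<noteq> j \<longrightarrow> ?L i \<inter> ?L j = {}"
      by blast
  qed (use fin finite_zigzag_lists[OF fin] in simp_all)
  also have "\<dots> = (\<Sum>j\<in>{j \<in> ?S. R j k}. zigzag_number n (n - card {i \<in> ?S. R i j}))"
  proof (rule sum.cong[OF refl])
    fix j assume j: "j \<in> {j \<in> ?S. R j k}"
    \<comment> \<open>The converse rank of \<open>j\<close> counts the letters above it: of the
      \<open>n\<close> letters of \<open>?S\<close> other than \<open>j\<close>, those not below
      \<open>j\<close>.\<close>
    have "{i \<in> ?S. R j i} = ?S - {j} - {i \<in> ?S. R i j}"
    proof -
      have "R i j \<or> R j i" if "i \<noteq> j" for i by (rule totalpD[OF Suc.prems(3) that])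
      moreover have "\<not> (R i j \<and> R j i)" for i
        using irr[of i] transpD[OF Suc.prems(2), of i j i] by blast
      ultimately show ?thesis using irr by blast
    qed
    moreover have "{i \<in> ?S. R i j} \<subseteq> ?S - {j}"
      using irr by blast
    ultimately have "card {i \<in> ?S. R j i} = n - card {i \<in> ?S. R i j}"
      using fin card j by (simp add: card_Diff_subset)
    moreover have "card (zigzag_lists R\<inverse>\<inverse> ?S j) = zigzag_number n (card {i \<in> ?S. R\<inverse>\<inverse> i j})"
    proof (rule Suc.IH)
      show "irreflp R\<inverse>\<inverse>" using irr by (intro irreflpI) simp
      show "transp R\<inverse>\<inverse>"
        by (intro transpI) (blast intro: transpD[OF Suc.prems(2)])
      show "totalp R\<inverse>\<inverse>"
        by (intro totalpI) (use totalpD[OF Suc.prems(3)] in auto)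
    qed (use fin card j in auto)
    ultimately show "card (?L j) = zigzag_number n (n - card {i \<in> ?S. R i j})"
      by (simp add: card_image)
  qed
  also have "\<dots> = (\<Sum>s<?r. zigzag_number n (n - s))"
    using sum.reindex_bij_betw[OF bij_betw_rank[OF Suc.prems(1-3) fin, of k],
        of "\<lambda>s. zigzag_number n (n - s)"] by (simp only: T)
  finally show ?case by simp
qed

section \<open>Alternating permutations in one-line notation\<close>

text \<open>The inverse map reads a word as a function and extends it by the identity, as
  \<open>permutes\<close> demands outside the carrier. Arguments start at 1 and list positions at 0,
  hence the index \<open>i - 1\<close>.\<close>

lemma bij_betw_permutes_lists:
  "bij_betw (\<lambda>\<sigma>. map \<sigma> [1..<Suc n]) {\<sigma>. \<sigma> permutes {1..n}} {xs. distinct xs \<and> set xs = {1..n}}"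
proof (rule bij_betwI[where g = "\<lambda>xs i. if i \<in> {1..n} then xs ! (i - 1) else i"])
  show "(\<lambda>\<sigma>. map \<sigma> [1..<Suc n]) \<in> {\<sigma>. \<sigma> permutes {1..n}} \<rightarrow> {xs. distinct xs \<and> set xs = {1..n}}"
  proof
    fix \<sigma> assume "\<sigma> \<in> {\<sigma>. \<sigma> permutes {1..n}}"
    then have s: "\<sigma> permutes {1..n}" by simp
    have "set [1..<Suc n] = {1..n}" by auto
    then show "map \<sigma> [1..<Suc n] \<in> {xs. distinct xs \<and> set xs = {1..n}}"
      using permutes_image[OF s] permutes_inj_on[OF s]
      by (simp add: distinct_map del: upt_Suc)
  qed
next
  show "(\<lambda>xs i. if i \<in> {1..n} then xs ! (i - 1) else i)
    \<in> {xs. distinct xs \<and> set xs = {1..n}} \<rightarrow> {\<sigma>. \<sigma> permutes {1..n}}"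
  proof
    fix xs :: "nat list" assume "xs \<in> {xs. distinct xs \<and> set xs = {1..n}}"
    then have xs: "distinct xs" "set xs = {1..n}" by auto
    then have len: "length xs = n" using distinct_card by fastforce
    have "bij_betw (\<lambda>i. i - 1) {1..n} {..<n}"
      by (rule bij_betwI[where g = Suc]) auto
    from bij_betw_trans[OF this bij_betw_nth[OF xs(1), of "{..<n}" "{1..n}"]]
    have "bij_betw (\<lambda>i. xs ! (i - 1)) {1..n} {1..n}" using xs len by (simp add: o_def)
    then have "bij_betw (\<lambda>i. if i \<in> {1..n} then xs ! (i - 1) else i) {1..n} {1..n}"
      by (rule bij_betw_cong[THEN iffD1, rotated]) auto
    then show "(\<lambda>i. if i \<in> {1..n} then xs ! (i - 1) else i) \<in> {\<sigma>. \<sigma> permutes {1..n}}"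
      by (auto intro!: bij_imp_permutes)
  qed
next
  fix \<sigma> assume "\<sigma> \<in> {\<sigma>. \<sigma> permutes {1..n}}"
  then show "(\<lambda>i. if i \<in> {1..n} then map \<sigma> [1..<Suc n] ! (i - 1) else i) = \<sigma>"
    by (auto simp: fun_eq_iff permutes_not_in simp del: upt_Suc)
next
  fix xs :: "nat list" assume "xs \<in> {xs. distinct xs \<and> set xs = {1..n}}"
  then have "length xs = n" using distinct_card by fastforce
  then show "map (\<lambda>i. if i \<in> {1..n} then xs ! (i - 1) else i) [1..<Suc n] = xs"
    by (intro nth_equalityI) (auto simp del: upt_Suc)
qed

text \<open>Descents at odd arguments, counted from 1, are descents at even list positions, counted
  from 0.\<close>

lemma alternating_iff_zigzag: "alternating n \<sigma> \<longleftrightarrow> zigzag (<) (map \<sigma> [1..<Suc n])"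
proof -
  have "(\<forall>i\<in>{1..<n}. P i) \<longleftrightarrow> (\<forall>i. Suc i < n \<longrightarrow> P (Suc i))" for P
    by (metis One_nat_def Suc_le_eq atLeastLessThan_iff gr0_conv_Suc zero_less_Suc)
  then show ?thesis
    unfolding alternating_def zigzag_iff_nth by (simp del: upt_Suc)
qed

text \<open>The index \<open>k - 1\<close> is the rank of the first letter \<open>k\<close> in
  \<open>{1..Suc n}\<close>.\<close>

lemma entringer_number_eq:
  assumes "k \<in> {1..Suc n}"
  shows "entringer_number (Suc n) k = zigzag_number n (k - 1)"
proof -
  let ?f = "\<lambda>\<sigma>. map \<sigma> [1..<Suc (Suc n)]"
  let ?A = "{\<sigma>. \<sigma> permutes {1..Suc n} \<and> alternating (Suc n) \<sigma> \<and> \<sigma> 1 = k}"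
  note bij = bij_betw_permutes_lists[of "Suc n"]
  have hd: "hd (?f \<sigma>) = \<sigma> 1" for \<sigma> :: "nat \<Rightarrow> nat" by (subst upt_conv_Cons) auto
  have inj: "inj_on ?f ?A" using bij by (auto simp: bij_betw_def intro: inj_on_subset)
  have img: "?f ` ?A = zigzag_lists (<) {1..Suc n} k"
  proof (intro equalityI subsetI)
    fix xs assume "xs \<in> ?f ` ?A"
    then obtain \<sigma> where s: "\<sigma> \<in> ?A" "xs = ?f \<sigma>" by blast
    have "xs \<in> {xs. distinct xs \<and> set xs = {1..Suc n}}"
      unfolding s(2) using s(1) by (intro bij_betw_apply[OF bij]) auto
    then show "xs \<in> zigzag_lists (<) {1..Suc n} k"
      using s hd[of \<sigma>] by (auto simp: zigzag_lists_def alternating_iff_zigzag simp del: upt_Suc)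
  next
    fix xs assume xs: "xs \<in> zigzag_lists (<) {1..Suc n} k"
    then have "xs \<in> ?f ` {\<sigma>. \<sigma> permutes {1..Suc n}}"
      using bij by (auto simp: bij_betw_def zigzag_lists_def)
    then obtain \<sigma> where s: "\<sigma> permutes {1..Suc n}" "xs = ?f \<sigma>" by blast
    then have "\<sigma> \<in> ?A" using xs hd[of \<sigma>]
      by (auto simp: zigzag_lists_def alternating_iff_zigzag simp del: upt_Suc)
    then show "xs \<in> ?f ` ?A" using s by blast
  qed
  have "entringer_number (Suc n) k = card (zigzag_lists (<) {1..Suc n} k)"
    unfolding entringer_number_def by (simp only: img[symmetric] card_image[OF inj])
  also have "\<dots> = zigzag_number n (card {j \<in> {1..Suc n}. j < k})"
    using assms by (intro card_zigzag_lists) auto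
  finally have "entringer_number (Suc n) k = zigzag_number n (card {j \<in> {1..Suc n}. j < k})" .
  moreover have "{j \<in> {1..Suc n}. j < k} = {1..<k}" using assms by auto
  ultimately show ?thesis by simp
qed

text \<open>Splitting by the first value gives the sum of a full row of the triangle, which by the
  recursion is the diagonal entry of the next row.\<close>

lemma euler_number_eq: "euler_number (Suc n) = zigzag_number (Suc n) (Suc n)"
proof -
  let ?A = "\<lambda>k. {\<sigma>. \<sigma> permutes {1..Suc n} \<and> alternating (Suc n) \<sigma> \<and> \<sigma> 1 = k}"
  have "\<sigma> 1 \<in> {1..Suc n}" if "\<sigma> permutes {1..Suc n}" for \<sigma>
    by (subst permutes_in_image[OF that]) simp
  then have "{\<sigma>. \<sigma> permutes {1..Suc n} \<and> alternating (Suc n) \<sigma>} = (\<Union>k\<in>{1..Suc n}. ?A k)"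
    by blast
  moreover have "finite (?A k)" for k
    by (rule finite_subset[OF _ finite_permutations[of "{1..Suc n}"]]) auto
  ultimately have "euler_number (Suc n) = (\<Sum>k\<in>{1..Suc n}. entringer_number (Suc n) k)"
    unfolding euler_number_def entringer_number_def
    by (simp only:) (rule card_UN_disjoint, auto)
  also have "\<dots> = (\<Sum>k\<in>{1..Suc n}. zigzag_number n (k - 1))"
    by (intro sum.cong refl entringer_number_eq)
  also have "\<dots> = (\<Sum>s<Suc n. zigzag_number n (n - s))"
    \<comment> \<open>Reversal of the summation order: for \<open>s = Suc n - k\<close> one has
      \<open>n - s = k - 1\<close>.\<close>
    by (rule sum.reindex_bij_witness[where i = "\<lambda>s. Suc n - s" and j = "\<lambda>k. Suc n - k"]) auto
  finally show ?thesis by simp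
qed

section \<open>Covers of a straight snake graph as column equations\<close>

abbreviation snake_covers :: "nat \<Rightarrow> nat list \<Rightarrow> ((nat \<times> nat) set \<Rightarrow> nat) set" where
  "snake_covers N x \<equiv> mixed_dimer_covers (straight_snake N) (column_labeling x)"

lemma finite_snake_covers: "finite (snake_covers N x)"
  by (rule finite_mixed_dimer_covers[OF finite_graph_straight_snake])

lemma vertical_neq_horizontal: "k > 0 \<Longrightarrow> vertical_edge j \<noteq> horizontal_edge r k"
  by (auto simp: vertical_edge_def horizontal_edge_def doubleton_eq_iff)

lemma vertical_edge_eq_iff: "vertical_edge j = vertical_edge k \<longleftrightarrow> j = k"
  by (auto simp: vertical_edge_def doubleton_eq_iff)

lemma horizontal_edge_eq_iff:
  "j > 0 \<Longrightarrow> k > 0 \<Longrightarrow> horizontal_edge r j = horizontal_edge s k \<longleftrightarrow> r = s \<and> j = k"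
  by (auto simp: horizontal_edge_def doubleton_eq_iff)

lemmas edge_simps = vertical_neq_horizontal vertical_neq_horizontal[symmetric]
  vertical_edge_eq_iff horizontal_edge_eq_iff

lemma verts_straight_snake: "verts (straight_snake N) = {1, 2} \<times> {0..N}"
  by (simp add: straight_snake_def)

lemma edges_straight_snake_iff:
  "e \<in> edges (straight_snake N) \<longleftrightarrow>
    (\<exists>k\<le>N. e = vertical_edge k) \<or> (\<exists>r\<in>{1, 2}. \<exists>k. 0 < k \<and> k \<le> N \<and> e = horizontal_edge r k)"
  by (simp only: straight_snake_def snd_conv) (fastforce simp: Suc_le_eq)

lemma edges_straight_snake_Suc:
  "edges (straight_snake (Suc N)) = edges (straight_snake N) \<union>
    {vertical_edge (Suc N), horizontal_edge 1 (Suc N), horizontal_edge 2 (Suc N)}"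
  unfolding set_eq_iff Un_iff edges_straight_snake_iff by (auto simp: le_Suc_eq)

lemma last_edges_notin:
  "vertical_edge (Suc N) \<notin> edges (straight_snake N)"
  "horizontal_edge r (Suc N) \<notin> edges (straight_snake N)"
  unfolding edges_straight_snake_iff by (auto simp: edge_simps)

lemma edges_straight_snakeI:
  "k \<le> N \<Longrightarrow> vertical_edge k \<in> edges (straight_snake N)"
  "r \<in> {1, 2} \<Longrightarrow> k > 0 \<Longrightarrow> k \<le> N \<Longrightarrow> horizontal_edge r k \<in> edges (straight_snake N)"
  unfolding edges_straight_snake_iff by blast+

lemma mem_vertical_edge_iff: "(r, k) \<in> vertical_edge j \<longleftrightarrow> r \<in> {1, 2} \<and> j = k"
  by (auto simp: vertical_edge_def)

lemma mem_horizontal_edge_iff: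
  "j > 0 \<Longrightarrow> (r, k) \<in> horizontal_edge s j \<longleftrightarrow> s = r \<and> (j = k \<or> j = Suc k)"
  by (auto simp: horizontal_edge_def)

text \<open>Besides its vertical edge, a vertex meets a horizontal edge on the left unless it is in
  column 0 and one on the right unless it is in column \<open>N\<close>. These edges are distinct,
  so the incidence sum splits into at most three terms, and later arguments can work with these
  equations alone.\<close>

lemma snake_covers_iff:
  "\<omega> \<in> snake_covers N x \<longleftrightarrow>
    \<omega> \<in> extensional (edges (straight_snake N)) \<and>
    (\<forall>r\<in>{1, 2}. \<forall>k\<le>N. \<omega> (vertical_edge k) + (if k = 0 then 0 else \<omega> (horizontal_edge r k)) +
      (if k < N then \<omega> (horizontal_edge r (Suc k)) else 0) = x ! k)"
proof -
  let ?inc = "\<lambda>r k. {e \<in> edges (straight_snake N). (r, k) \<in> e}"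
  have sum: "sum \<omega> (?inc r k) =
      \<omega> (vertical_edge k) + (if k = 0 then 0 else \<omega> (horizontal_edge r k)) +
      (if k < N then \<omega> (horizontal_edge r (Suc k)) else 0)"
    if r: "r \<in> {1, 2}" and k: "k \<le> N" for r k
  proof -
    have "?inc r k = insert (vertical_edge k)
        ((if k = 0 then {} else {horizontal_edge r k}) \<union>
         (if k < N then {horizontal_edge r (Suc k)} else {}))" (is "_ = ?I")
    proof (intro equalityI subsetI)
      fix e assume "e \<in> ?inc r k"
      then have "e \<in> edges (straight_snake N)" and e: "(r, k) \<in> e" by auto
      then consider j where "e = vertical_edge j"
        | s j where "0 < j" "j \<le> N" "e = horizontal_edge s j"
        unfolding edges_straight_snake_iff by blast
      then show "e \<in> ?I"
        using e by cases (auto simp: mem_vertical_edge_iff mem_horizontal_edge_iff)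
    next
      fix e assume "e \<in> ?I"
      then consider "e = vertical_edge k" | "0 < k" "e = horizontal_edge r k"
        | "k < N" "e = horizontal_edge r (Suc k)"
        by (auto split: if_splits)
      then show "e \<in> ?inc r k"
        using r k
        by cases (simp_all add: edges_straight_snakeI mem_vertical_edge_iff mem_horizontal_edge_iff)
    qed
    then show ?thesis by (auto simp: edge_simps)
  qed
  have "\<omega> \<in> snake_covers N x \<longleftrightarrow> \<omega> \<in> extensional (edges (straight_snake N)) \<and>
      (\<forall>r\<in>{1, 2}. \<forall>k\<le>N. sum \<omega> (?inc r k) = x ! k)"
    unfolding mixed_dimer_covers_def verts_straight_snake
    by (auto simp: PiE_def column_labeling_def)
  also have "\<dots> \<longleftrightarrow> \<omega> \<in> extensional (edges (straight_snake N)) \<and>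
    (\<forall>r\<in>{1, 2}. \<forall>k\<le>N. \<omega> (vertical_edge k) + (if k = 0 then 0 else \<omega> (horizontal_edge r k)) +
      (if k < N then \<omega> (horizontal_edge r (Suc k)) else 0) = x ! k)"
    by (intro conj_cong ball_cong refl iff_allI imp_cong) (simp only: sum)
  finally show ?thesis .
qed

section \<open>Deletion of the last column\<close>

text \<open>The parameter is \<open>h\<close>, the multiplicity forced on both last horizontal
  edges, because this is what the preceding label loses. The case distinction keeps truncated
  subtraction from turning an impossible label \<open>a - h\<close> into 0.\<close>

lemma card_snake_covers_last_edge:
  assumes x: "length x = N" and h: "h \<le> b"
  shows "card {\<omega> \<in> snake_covers (Suc N) (x @ [a, b]). \<omega> (vertical_edge (Suc N)) = b - h} =
    (if h \<le> a then card (snake_covers N (x @ [a - h])) else 0)"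
proof -
  let ?E = "edges (straight_snake N)"
  let ?A = "{\<omega> \<in> snake_covers (Suc N) (x @ [a, b]). \<omega> (vertical_edge (Suc N)) = b - h}"
  \<comment> \<open>The inverse of restriction to the smaller graph: it puts back the only possible
    values on the three deleted edges.\<close>
  let ?ext = "\<lambda>\<omega>. \<omega>(vertical_edge (Suc N) := b - h, horizontal_edge 1 (Suc N) := h,
    horizontal_edge 2 (Suc N) := h)"
  have nth: "(x @ [a, b]) ! k = (x @ [a - h]) ! k" if "k < N" for k
    using that x by (simp add: nth_append)
  have nthN: "(x @ [a, b]) ! N = a" "(x @ [a, b]) ! Suc N = b" "(x @ [a - h]) ! N = a - h"
    using x by (auto simp: nth_append)
  have last: "\<omega> (horizontal_edge r (Suc N)) = h" if "\<omega> \<in> ?A" "r \<in> {1, 2}" for \<omega> r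
  proof -
    have "\<omega> (vertical_edge (Suc N)) + \<omega> (horizontal_edge r (Suc N)) = b"
      using that nthN(2) by (auto simp: snake_covers_iff)
    then show ?thesis using that h by auto
  qed
  have colN: "\<omega> (vertical_edge N) + (if N = 0 then 0 else \<omega> (horizontal_edge r N)) + h = a"
    if "\<omega> \<in> ?A" "r \<in> {1, 2}" for \<omega> r
  proof -
    have "\<omega> (vertical_edge N) + (if N = 0 then 0 else \<omega> (horizontal_edge r N)) +
        \<omega> (horizontal_edge r (Suc N)) = a"
      using that nthN(1) unfolding snake_covers_iff by (auto dest!: spec[of _ N])
    then show ?thesis using last[OF that] by simp
  qed
  show ?thesis
  proof (cases "h \<le> a")
    case False
    \<comment> \<open>In \<open>colN\<close>, \<open>h\<close> is a summand of a total equal to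
      \<open>a\<close>, which is impossible for \<open>h > a\<close>.\<close>
    then have "?A = {}" using colN[of _ 1] by fastforce
    then show ?thesis using False by (simp only: card.empty if_False)
  next
    case True
    have "bij_betw (\<lambda>\<omega>. restrict \<omega> ?E) ?A (snake_covers N (x @ [a - h]))"
    proof (rule bij_betwI[where g = ?ext])
      show "(\<lambda>\<omega>. restrict \<omega> ?E) \<in> ?A \<rightarrow> snake_covers N (x @ [a - h])"
      proof
        fix \<omega> assume w: "\<omega> \<in> ?A"
        have col: "\<omega> (vertical_edge k) + (if k = 0 then 0 else \<omega> (horizontal_edge r k)) +
            (if k < N then \<omega> (horizontal_edge r (Suc k)) else 0) = (x @ [a - h]) ! k"
          if "r \<in> {1, 2}" "k \<le> N" for r k
        proof (cases "k < N")
          case True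
          have "\<omega> (vertical_edge k) + (if k = 0 then 0 else \<omega> (horizontal_edge r k)) +
            (if k < Suc N then \<omega> (horizontal_edge r (Suc k)) else 0) = (x @ [a, b]) ! k"
            using w that(1) le_SucI[OF that(2)] unfolding snake_covers_iff by blast
          then show ?thesis using True nth by simp
        next
          case False
          then show ?thesis using colN[OF w that(1)] that nthN(3) by auto
        qed
        show "restrict \<omega> ?E \<in> snake_covers N (x @ [a - h])"
          unfolding snake_covers_iff
        proof (intro conjI ballI allI impI)
          fix r k :: nat assume rk: "r \<in> {1, 2}" "k \<le> N"
          show "restrict \<omega> ?E (vertical_edge k) +
              (if k = 0 then 0 else restrict \<omega> ?E (horizontal_edge r k)) +
              (if k < N then restrict \<omega> ?E (horizontal_edge r (Suc k)) else 0) = (x @ [a - h]) ! k"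
            using col[OF rk] edges_straight_snakeI(1)[OF rk(2)] edges_straight_snakeI(2)[OF rk(1)] rk(2)
            by (cases "k = 0"; cases "k < N") simp_all
        qed simp
      qed
    next
      show "?ext \<in> snake_covers N (x @ [a - h]) \<rightarrow> ?A"
      proof
        fix \<omega> assume w: "\<omega> \<in> snake_covers N (x @ [a - h])"
        have "?ext \<omega> (vertical_edge k) + (if k = 0 then 0 else ?ext \<omega> (horizontal_edge r k)) +
            (if k < Suc N then ?ext \<omega> (horizontal_edge r (Suc k)) else 0) = (x @ [a, b]) ! k"
          if r: "r \<in> {1, 2}" and k: "k \<le> Suc N" for r k
        proof -
          have old: "\<omega> (vertical_edge k) + (if k = 0 then 0 else \<omega> (horizontal_edge r k)) +
            (if k < N then \<omega> (horizontal_edge r (Suc k)) else 0) = (x @ [a - h]) ! k" if "k \<le> N"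
            using w r that unfolding snake_covers_iff by blast
          consider "k < N" | "k = N" | "k = Suc N" using k by linarith
          then show ?thesis
          proof cases
            case 1
            then show ?thesis using old nth[of k] by (cases "k = 0") (simp_all add: edge_simps)
          next
            case 2
            then show ?thesis using old r nthN True by (auto simp: edge_simps)
          next
            case 3
            then show ?thesis using r nthN h by (auto simp: edge_simps)
          qed
        qed
        moreover have "?ext \<omega> \<in> extensional (edges (straight_snake (Suc N)))"
          using w by (auto simp: snake_covers_iff extensional_def edges_straight_snake_Suc)
        ultimately show "?ext \<omega> \<in> ?A"
          unfolding snake_covers_iff mem_Collect_eq by (auto simp: edge_simps)
      qed
    next
      fix \<omega> assume w: "\<omega> \<in> ?A"
      show "?ext (restrict \<omega> ?E) = \<omega>"
      proof
        fix e
        \<comment> \<open>Restriction loses only the values on the three new edges: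
          \<open>last\<close> and the prescribed vertical multiplicity recover them, and off the
          larger edge set both sides are \<open>undefined\<close>.\<close>
        have "\<omega> e = undefined" if "e \<notin> edges (straight_snake (Suc N))"
          using w that by (auto simp: snake_covers_iff extensional_def)
        then show "?ext (restrict \<omega> ?E) e = \<omega> e"
          using w last[OF w] by (auto simp: edges_straight_snake_Suc)
      qed
    next
      fix \<omega> assume w: "\<omega> \<in> snake_covers N (x @ [a - h])"
      then have "\<omega> \<in> extensional ?E" by (simp add: snake_covers_iff)
      then show "restrict (?ext \<omega>) ?E = \<omega>"
        using last_edges_notin by (intro extensionalityI[of _ ?E]) auto
    qed
    then show ?thesis using True by (simp add: bij_betw_same_card)
  qed
qed

lemma card_snake_covers_0: "card (snake_covers 0 [y]) = 1"
proof -
  have e: "edges (straight_snake 0) = {vertical_edge 0}" by (auto simp: straight_snake_def)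
  have "snake_covers 0 [y] = {\<lambda>e\<in>{vertical_edge 0}. y}"
    by (auto simp: set_eq_iff snake_covers_iff e intro: extensionalityI[of _ "{vertical_edge 0}"])
  then show ?thesis by simp
qed

lemma card_snake_covers_Suc:
  assumes "length x = N"
  shows "card (snake_covers (Suc N) (x @ [a, b])) =
    (\<Sum>h\<le>b. if h \<le> a then card (snake_covers N (x @ [a - h])) else 0)"
proof -
  let ?A = "\<lambda>h. {\<omega> \<in> snake_covers (Suc N) (x @ [a, b]). \<omega> (vertical_edge (Suc N)) = b - h}"
  have "\<exists>h\<le>b. \<omega> \<in> ?A h" if "\<omega> \<in> snake_covers (Suc N) (x @ [a, b])" for \<omega>
  proof -
    have "\<omega> (vertical_edge (Suc N)) + \<omega> (horizontal_edge 1 (Suc N)) = b"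
      using that assms by (auto simp: snake_covers_iff nth_append)
    \<comment> \<open>The parameter \<open>h\<close> is read off from the bottom horizontal edge;
      distinct \<open>h\<close> up to \<open>b\<close> give distinct vertical multiplicities, so the
      classes are disjoint.\<close>
    then show ?thesis using that by (intro exI[of _ "\<omega> (horizontal_edge 1 (Suc N))"]) auto
  qed
  then have "snake_covers (Suc N) (x @ [a, b]) = (\<Union>h\<in>{..b}. ?A h)" by blast
  then have "card (snake_covers (Suc N) (x @ [a, b])) = card (\<Union>h\<in>{..b}. ?A h)" by (rule arg_cong)
  also have "\<dots> = (\<Sum>h\<le>b. card (?A h))"
    by (rule card_UN_disjoint) (auto intro: finite_subset[OF _ finite_snake_covers])
  also have "\<dots> = (\<Sum>h\<le>b. if h \<le> a then card (snake_covers N (x @ [a - h])) else 0)"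
    by (intro sum.cong refl card_snake_covers_last_edge[OF assms]) auto
  finally show ?thesis .
qed

section \<open>Comparison with the Entringer triangle\<close>

lemma card_snake_covers:
  "y \<le> Suc N \<Longrightarrow> card (snake_covers N ([1..<Suc N] @ [y])) = zigzag_number (N + 2) (Suc y)"
proof (induction N arbitrary: y)
  case 0
  then have "y = 0 \<or> y = 1" by auto
  then show ?case using card_snake_covers_0[of y] by (auto simp: numeral_2_eq_2)
next
  case (Suc N)
  have "card (snake_covers (Suc N) ([1..<Suc (Suc N)] @ [y])) =
      card (snake_covers (Suc N) ([1..<Suc N] @ [Suc N, y]))"
    by simp
  also have "\<dots> = (\<Sum>h\<le>y. if h \<le> Suc N
      then card (snake_covers N ([1..<Suc N] @ [Suc N - h])) else 0)"
    by (rule card_snake_covers_Suc) simp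
  also have "\<dots> = (\<Sum>h<Suc y. zigzag_number (N + 2) (N + 2 - h))"
  proof (rule sum.cong)
    fix h assume "h \<in> {..<Suc y}"
    \<comment> \<open>The only \<open>h\<close> exceeding the label \<open>Suc N\<close> is
      \<open>N + 2\<close>, possible when \<open>y\<close> is maximal. It contributes 0 on both
      sides, since \<open>zigzag_number (N + 2) 0\<close> is an empty sum.\<close>
    then have "h = N + 2" if "\<not> h \<le> Suc N" using that Suc.prems by auto
    then show "(if h \<le> Suc N then card (snake_covers N ([1..<Suc N] @ [Suc N - h])) else 0) =
        zigzag_number (N + 2) (N + 2 - h)"
      using Suc.IH[of "Suc N - h"] by (cases "h \<le> Suc N") (simp_all add: Suc_diff_le del: upt_Suc)
  qed auto
  finally show ?case by simp
qed

lemma standard_covers_eq: "standard_covers N = snake_covers N ([1..<Suc N] @ [Suc N])"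
  unfolding standard_covers_def by simp

theorem theorem3:
  shows "(\<forall>n::nat. n \<ge> 2 \<longrightarrow> card (standard_covers (n - 2)) = euler_number n) \<and>
    (\<forall>n k::nat. n \<ge> 3 \<and> 1 \<le> k \<and> k \<le> n \<longrightarrow>
       card {\<omega> \<in> standard_covers (n - 2). \<omega> (vertical_edge (n - 2)) = n - k}
         = entringer_number n (n + 1 - k) \<and>
       (n \<ge> 4 \<longrightarrow>
         card {\<omega> \<in> standard_covers (n - 2). \<omega> (vertical_edge (n - 2)) = n - k}
           = (if k \<le> n - 1
              then card (mixed_dimer_covers (straight_snake (n - 3))
                           (column_labeling ([1..<n - 2] @ [n - 1 - k])))
              else 0)))"
proof -
  have a: "card (standard_covers (n - 2)) = euler_number n" if n: "n \<ge> 2" for n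
  proof -
    obtain N where "n = N + 2" using n by (metis add.commute le_Suc_ex)
    then show ?thesis
      using card_snake_covers[of "Suc N" N] euler_number_eq[of "Suc N"]
      by (simp add: standard_covers_eq del: upt_Suc zigzag_number.simps)
  qed
  \<comment> \<open>The reduction to the smaller graph is established from \<open>n = 3\<close> on,
    since the Entringer equality \<open>c\<close> is deduced from it.\<close>
  have b: "card {\<omega> \<in> standard_covers (n - 2). \<omega> (vertical_edge (n - 2)) = n - k} =
      (if k \<le> n - 1 then card (snake_covers (n - 3) ([1..<n - 2] @ [n - 1 - k])) else 0)"
    (is "?lhs = ?rhs")
    and c: "card {\<omega> \<in> standard_covers (n - 2). \<omega> (vertical_edge (n - 2)) = n - k} =
      entringer_number n (n + 1 - k)"
    if n: "n \<ge> 3" and k: "1 \<le> k" "k \<le> n" for n k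
  proof -
    obtain N where N: "n = N + 3" using n by (metis add.commute le_Suc_ex)
    \<comment> \<open>Vertical multiplicity \<open>n - k\<close> under last label
      \<open>n - 1\<close> leaves \<open>h = k - 1\<close> for the horizontal edges, so the
      preceding label \<open>n - 2\<close> drops to \<open>n - 1 - k\<close>.\<close>
    obtain h where h: "k = Suc h" using k by (cases k) auto
    have "?lhs = card {\<omega> \<in> snake_covers (Suc N) ([1..<Suc N] @ [Suc N, Suc (Suc N)]).
        \<omega> (vertical_edge (Suc N)) = Suc (Suc N) - h}"
      by (simp add: standard_covers_eq N h)
    also have "\<dots> = (if h \<le> Suc N then card (snake_covers N ([1..<Suc N] @ [Suc N - h])) else 0)"
      using k N h by (intro card_snake_covers_last_edge) auto
    finally show eq: "?lhs = ?rhs" by (simp add: N h del: upt_Suc)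
    have E: "entringer_number n (n + 1 - k) = zigzag_number (N + 2) (n - k)"
    proof -
      have "n + 1 - k \<in> {1..Suc (N + 2)}" "Suc (N + 2) = n" "n + 1 - k - 1 = n - k"
        using k N by auto
      then show ?thesis using entringer_number_eq[of "n + 1 - k" "N + 2"] by (simp only:)
    qed
    show "?lhs = entringer_number n (n + 1 - k)"
    proof (cases "k \<le> n - 1")
      case True
      then have "n - 1 - k \<le> Suc N" "Suc (n - 1 - k) = n - k" "n - 3 = N" "n - 2 = Suc N"
        using k N by auto
      then show ?thesis unfolding E eq
        using card_snake_covers[of "n - 1 - k" N] True by (simp only: if_True)
    next
      case False
      \<comment> \<open>Here \<open>k = n\<close>: no cover has last vertical multiplicity 0, just
        as no alternating permutation of this length starts with 1.\<close>
      then show ?thesis unfolding E eq using k by simp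
    qed
  qed
  show ?thesis using a b c by simp
qed

end
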